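(* Let $h\in\mathscr{A}_p$ (possibly sign-changing) with $|\{x\in\Omega: h(x)>0\}|>0$ and let $\lambda\in\mathbb{R}$. Let $u\in W_0^{s,p}(\Omega)$ be any eigenfunction (nontrivial weak solution) of $$(-\Delta)_p^su=\lambda h(x)|u|^{p-2}u \ \text{ in } \Omega,\qquad u=0\ \text{ in } \mathbb{R}^N\setminus \Omega.$$ Then $u\in L^\infty (\mathbb{R}^N)$.
   Context: Standing assumptions: $N\ge 2$, $\Omega\subset\mathbb{R}^N$ is a bounded domain with Lipschitz boundary, $p\in(1,\infty)$, $s\in(0,1)$; $|E|$ denotes the Lebesgue measure of a set $E$. Function space: $W_0^{s,p}(\Omega):=\{u\in W^{s,p}(\mathbb{R}^N): u=0 \text{ in } \mathbb{R}^N\setminus\Omega\}$. Set $p_s^\ast:=\frac{Np}{N-sp}$ if $N>sp$ and $p_s^\ast:=\infty$ if $N\le sp$ (with $1/\infty=0$). Weights: for $q\in[1,p_s^\ast)$, $\mathscr{A}_q$ is the class of measurable functions $h$ on $\Omega$ such that $h\in L^r(\Omega)$ for some $r\in(1,\infty)$ satisfying $\frac1r+\frac{q}{p_s^\ast}<1$. Weak solution: $u\in W_0^{s,p}(\Omega)$ is a weak solution of the problem if for all $v\in W_0^{s,p}(\Omega)$ $$\int_{\mathbb{R}^{2N}}\frac{|u(x)-u(y)|^{p-2}(u(x)-u(y))(v(x)-v(y))}{|x-y|^{N+sp}}\,dx\,dy=\lambda\int_\Omega h(x)|u|^{p-2}u\,v\,dx.$$ *)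

theory Defs
  imports "HOL-Analysis.Analysis"
begin

text \<open>
  Functions are actual functions rather than classes modulo null sets, so conditions on elements of
  a function space are imposed almost everywhere. Measurability is Lebesgue measurability, and
  \<open>\<real>\<^sup>2\<^sup>N\<close> carries the measure \<^term>\<open>lebesgue :: ('a :: euclidean_space \<times> 'a) measure\<close>.
\<close>

definition Lp_space :: "'a measure \<Rightarrow> real \<Rightarrow> ('a \<Rightarrow> real) set" where
  "Lp_space M r = {f \<in> borel_measurable M. integrable M (\<lambda>x. \<bar>f x\<bar> powr r)}"

definition Linf_space :: "'a measure \<Rightarrow> ('a \<Rightarrow> real) set" where
  "Linf_space M = {f \<in> borel_measurable M. \<exists>C. AE x in M. \<bar>f x\<bar> \<le> C}"

text \<open>
  Locally, after a rotation taking the last coordinate axis to the direction \<open>e\<close>, the set is the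
  region strictly above the graph of a Lipschitz function on the hyperplane orthogonal to \<open>e\<close>;
  \<open>x - (x \<bullet> e) *\<^sub>R e\<close> is the projection of \<open>x\<close> to that hyperplane.
\<close>

definition lipschitz_boundary :: "'a :: euclidean_space set \<Rightarrow> bool" where
  "lipschitz_boundary \<Omega> \<longleftrightarrow>
     (\<forall>z \<in> frontier \<Omega>. \<exists>r > 0. \<exists>e. \<exists>L. \<exists>\<phi> :: 'a \<Rightarrow> real.
        norm e = 1 \<and> lipschitz_on L {y. y \<bullet> e = 0} \<phi> \<and>
        \<Omega> \<inter> ball z r = {x \<in> ball z r. \<phi> (x - (x \<bullet> e) *\<^sub>R e) < x \<bullet> e})"

definition bounded_lipschitz_domain :: "'a :: euclidean_space set \<Rightarrow> bool" where
  "bounded_lipschitz_domain \<Omega> \<longleftrightarrow>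
     open \<Omega> \<and> connected \<Omega> \<and> \<Omega> \<noteq> {} \<and> bounded \<Omega> \<and> lipschitz_boundary \<Omega>"

text \<open>
  The integrand of the Gagliardo seminorm. On the (null) diagonal it is \<open>0\<close>, by \<open>0 powr a = 0\<close> and
  \<open>x / 0 = 0\<close>.
\<close>

definition fractional_sobolev :: "real \<Rightarrow> real \<Rightarrow> ('a :: euclidean_space \<Rightarrow> real) set" where
  "fractional_sobolev s p =
     {u \<in> Lp_space lebesgue p.
        integrable (lebesgue :: ('a \<times> 'a) measure)
          (\<lambda>(x, y). \<bar>u x - u y\<bar> powr p / norm (x - y) powr (real DIM('a) + s * p))}"

definition fractional_sobolev0 ::
    "real \<Rightarrow> real \<Rightarrow> 'a :: euclidean_space set \<Rightarrow> ('a \<Rightarrow> real) set" where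
  "fractional_sobolev0 s p \<Omega> =
     {u \<in> fractional_sobolev s p. AE x in lebesgue. x \<notin> \<Omega> \<longrightarrow> u x = 0}"

definition critical_exponent :: "nat \<Rightarrow> real \<Rightarrow> real \<Rightarrow> ereal" where
  "critical_exponent N s p =
     (if s * p < real N then ereal (real N * p / (real N - s * p)) else \<infinity>)"

text \<open>
  Division is that of \<^typ>\<open>ereal\<close>, where \<open>q / \<infinity> = 0\<close>. The last condition forces
  \<open>q < critical_exponent DIM('a) s p\<close>.
\<close>

definition weight_class ::
    "real \<Rightarrow> real \<Rightarrow> 'a :: euclidean_space set \<Rightarrow> real \<Rightarrow> ('a \<Rightarrow> real) set" where
  "weight_class s p \<Omega> q =
     {h \<in> borel_measurable (lebesgue_on \<Omega>).
        \<exists>r > 1. h \<in> Lp_space (lebesgue_on \<Omega>) r \<and>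
          ereal (1 / r) + ereal q / critical_exponent DIM('a) s p < 1}"

text \<open>
  For \<open>p < 2\<close> the expression \<open>\<bar>t\<bar> powr (p - 2) * t\<close> is \<open>0\<close> at \<open>t = 0\<close>, as intended.
  Integrability of both integrands is not part of the definition: it follows from
  Hoelder's inequality on the left, and with the fractional Sobolev embedding on the right when
  \<open>h \<in> weight_class s p \<Omega> p\<close>.
\<close>

definition weak_solution ::
    "real \<Rightarrow> real \<Rightarrow> 'a :: euclidean_space set \<Rightarrow> ('a \<Rightarrow> real) \<Rightarrow> real \<Rightarrow> ('a \<Rightarrow> real) \<Rightarrow> bool" where
  "weak_solution s p \<Omega> h lam u \<longleftrightarrow>
     u \<in> fractional_sobolev0 s p \<Omega> \<and>
     (\<forall>v \<in> fractional_sobolev0 s p \<Omega>.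
        integral\<^sup>L (lebesgue :: ('a \<times> 'a) measure)
          (\<lambda>(x, y). \<bar>u x - u y\<bar> powr (p - 2) * (u x - u y) * (v x - v y)
                    / norm (x - y) powr (real DIM('a) + s * p))
        = lam * integral\<^sup>L (lebesgue_on \<Omega>) (\<lambda>x. h x * \<bar>u x\<bar> powr (p - 2) * u x * v x))"

definition eigenfunction ::
    "real \<Rightarrow> real \<Rightarrow> 'a :: euclidean_space set \<Rightarrow> ('a \<Rightarrow> real) \<Rightarrow> real \<Rightarrow> ('a \<Rightarrow> real) \<Rightarrow> bool" where
  "eigenfunction s p \<Omega> h lam u \<longleftrightarrow>
     weak_solution s p \<Omega> h lam u \<and> \<not> (AE x in lebesgue. u x = 0)"

end

theory Submission
  imports Defs
begin

text \<open>
  Boundedness is obtained by De Giorgi's level set method. Write \<open>N\<close> for the dimension and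
  \<open>\<theta> = s * p / N\<close>; let \<open>h\<close> be in \<open>L\<^sup>r\<close>, put \<open>q = r / (r - 1)\<close> and \<open>m = p * q\<close>. The assumption on the
  weight gives \<open>1 / r < \<theta>\<close>, whether or not \<open>s * p < N\<close> (\<open>weight_exponent_bound\<close>), and this is the
  subcriticality from which every gain below stems.

  The Sobolev embedding needed here has an elementary proof. If \<open>w x > t\<close> and \<open>{w > t}\<close> has volume
  at most \<open>B\<close>, then a ball about \<open>x\<close> of volume \<open>2 * B\<close> contains a set of volume at least \<open>B\<close> on
  which \<open>w \<le> t\<close>, and this set alone makes the inner integral
  \<open>\<integral> \<bar>w x - w y\<bar>\<^sup>p / \<bar>x - y\<bar>\<^sup>N\<^sup>+\<^sup>s\<^sup>p dy\<close> at least a multiple of \<open>(w x - t)\<^sup>p * B powr - \<theta>\<close>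
  (\<open>jump_le_gagliardo_density\<close>). Taking \<open>t = w x / 2\<close>, and for \<open>B\<close> the smaller of the volume of the
  support and the Chebyshev bound by \<open>\<integral> w\<^sup>m\<close>, yields after integration in \<open>x\<close>
  \<open>\<parallel>w\<parallel>\<^sub>m\<^sup>p \<le> C * \<bar>{w > 0}\<bar> powr (\<theta> - 1 / r) * [w]\<^sup>p\<close>, where \<open>[w]\<^sup>p\<close> is the Gagliardo energy
  (\<open>fractional_sobolev_inequality\<close>).

  Testing the equation with the truncation \<open>w = (u - k)\<^sup>+\<close> bounds \<open>[w]\<^sup>p\<close> by
  \<open>\<bar>lam\<bar> * \<integral>\<^bsub>{u > k}\<^esub> \<bar>h\<bar> * \<bar>u\<bar>\<^sup>p\<close> (\<open>caccioppoli\<close>). Hoelder's inequality and \<open>u = w + k\<close> on \<open>{u > k}\<close>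
  turn this, with the volume \<open>a\<close> of \<open>{u > k}\<close>, \<open>I = \<integral> w\<^sup>m\<close> and \<open>\<gamma> = (\<theta> - 1 / r) * q > 0\<close>, into
  \<open>I \<le> C * a powr \<gamma> * (I + k\<^sup>m * a)\<close>. For large \<open>k\<close> the factor \<open>C * a powr \<gamma>\<close> is at most \<open>1 / 2\<close>, the
  term with \<open>I\<close> is absorbed, and Chebyshev's inequality gives
  \<open>\<bar>{u > l}\<bar> \<le> 2 * C * (k / (l - k))\<^sup>m * \<bar>{u > k}\<bar> powr (1 + \<gamma>)\<close> for \<open>l > k\<close>. As the last exponent exceeds \<open>1\<close>,
  iteration along levels \<open>k\<^sub>j\<close> increasing to \<open>2 * K\<close> makes \<open>\<bar>{u > 2 * K}\<bar>\<close> vanish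
  (\<open>fast_decay_imp_zero\<close>). The same holds for \<open>- u\<close>, which solves the same equation.
\<close>

section \<open>Auxiliary inequalities for integrals and powers\<close>

text \<open>
  Young's inequality, applied pointwise to the functions normalised by the bounds \<open>F\<close> and \<open>G\<close>.
  Positive upper bounds in place of the exact norms avoid division by a norm that is \<open>0\<close>.
\<close>

lemma nn_integral_Holder:
  fixes f g :: "'a \<Rightarrow> real"
  assumes [measurable]: "f \<in> borel_measurable M" "g \<in> borel_measurable M"
    and nonneg: "\<And>x. f x \<ge> 0" "\<And>x. g x \<ge> 0"
    and conj: "p > 1" "q > 1" "1 / p + 1 / q = 1"
    and pos: "F > 0" "G > 0"
    and F: "(\<integral>\<^sup>+x. ennreal (f x powr p) \<partial>M) \<le> ennreal F"
    and G: "(\<integral>\<^sup>+x. ennreal (g x powr q) \<partial>M) \<le> ennreal G"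
  shows "(\<integral>\<^sup>+x. ennreal (f x * g x) \<partial>M) \<le> ennreal (F powr (1 / p) * G powr (1 / q))"
proof -
  define c where "c = F powr (1 / p) * G powr (1 / q)"
  have c0: "c > 0" using pos by (simp add: c_def)
  have young: "f x * g x \<le> c / (p * F) * f x powr p + c / (q * G) * g x powr q" for x
  proof -
    have "(f x / F powr (1/p)) * (g x / G powr (1/q))
        \<le> (f x / F powr (1/p)) powr p / p + (g x / G powr (1/q)) powr q / q"
      by (rule Youngs_inequality) (use nonneg conj in auto)
    also have "\<dots> = f x powr p / (p * F) + g x powr q / (q * G)"
      using pos conj nonneg by (simp add: powr_divide powr_powr mult.commute)
    finally have "c * ((f x / F powr (1/p)) * (g x / G powr (1/q)))
        \<le> c * (f x powr p / (p * F) + g x powr q / (q * G))"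
      using c0 by (intro mult_left_mono) auto
    then show ?thesis
      using pos by (simp add: c_def algebra_simps)
  qed
  have "(\<integral>\<^sup>+x. ennreal (f x * g x) \<partial>M)
      \<le> (\<integral>\<^sup>+x. ennreal (c / (p * F)) * ennreal (f x powr p)
               + ennreal (c / (q * G)) * ennreal (g x powr q) \<partial>M)"
    using c0 pos conj young
    by (intro nn_integral_mono) (simp flip: ennreal_mult ennreal_plus add: ennreal_leI)
  also have "\<dots> = ennreal (c / (p * F)) * (\<integral>\<^sup>+x. ennreal (f x powr p) \<partial>M)
               + ennreal (c / (q * G)) * (\<integral>\<^sup>+x. ennreal (g x powr q) \<partial>M)"
    by (simp add: nn_integral_add nn_integral_cmult)
  also have "\<dots> \<le> ennreal (c / (p * F)) * ennreal F + ennreal (c / (q * G)) * ennreal G"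
    by (intro add_mono mult_left_mono F G) auto
  also have "\<dots> = ennreal (c / (p * F) * F + c / (q * G) * G)"
    using c0 pos conj by (simp flip: ennreal_mult ennreal_plus)
  also have "c / (p * F) * F + c / (q * G) * G = c * (1 / p + 1 / q)"
    using pos conj by (simp add: field_simps)
  finally show ?thesis using conj by (simp add: c_def)
qed

lemma powr_add_le:
  fixes x y m :: real
  assumes "x \<ge> 0" "y \<ge> 0" "m \<ge> 0"
  shows "(x + y) powr m \<le> 2 powr m * (x powr m + y powr m)"
proof -
  have "(x + y) powr m \<le> (2 * max x y) powr m"
    using assms by (intro powr_mono2) auto
  also have "\<dots> = 2 powr m * max x y powr m" using assms by (simp add: powr_mult)
  also have "\<dots> \<le> 2 powr m * (x powr m + y powr m)"
    by (intro mult_left_mono) (auto simp: max_def)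
  finally show ?thesis .
qed

lemma emeasure_superlevel_le:
  fixes f :: "'a \<Rightarrow> real"
  assumes [measurable]: "f \<in> borel_measurable M" and q: "q > 0" and t: "t > 0"
    and I: "(\<integral>\<^sup>+x. ennreal (\<bar>f x\<bar> powr q) \<partial>M) \<le> ennreal I" "I \<ge> 0"
  shows "emeasure M {x \<in> space M. f x > t} \<le> ennreal (I / t powr q)"
proof -
  have "emeasure M {x \<in> space M. f x > t} = (\<integral>\<^sup>+x. indicator {x \<in> space M. f x > t} x \<partial>M)"
    by simp
  also have "\<dots> \<le> (\<integral>\<^sup>+x. ennreal (1 / t powr q) * ennreal (\<bar>f x\<bar> powr q) \<partial>M)"
  proof (intro nn_integral_mono)
    fix x
    show "indicator {x \<in> space M. f x > t} x \<le> ennreal (1 / t powr q) * ennreal (\<bar>f x\<bar> powr q)"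
    proof (cases "f x > t")
      case True
      then have "t powr q \<le> \<bar>f x\<bar> powr q" using t q by (intro powr_mono2) auto
      then have "1 \<le> 1 / t powr q * \<bar>f x\<bar> powr q" using t by (simp add: field_simps)
      then have "ennreal 1 \<le> ennreal (1 / t powr q * \<bar>f x\<bar> powr q)" by (rule ennreal_leI)
      also have "\<dots> = ennreal (1 / t powr q) * ennreal (\<bar>f x\<bar> powr q)"
        by (rule ennreal_mult) auto
      finally show ?thesis by (simp add: indicator_def)
    qed simp
  qed
  also have "\<dots> = ennreal (1 / t powr q) * (\<integral>\<^sup>+x. ennreal (\<bar>f x\<bar> powr q) \<partial>M)"
    by (simp add: nn_integral_cmult)
  also have "\<dots> \<le> ennreal (1 / t powr q) * ennreal I"
    by (intro mult_left_mono I) auto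
  also have "\<dots> = ennreal (I / t powr q)" using I by (simp flip: ennreal_mult)
  finally show ?thesis .
qed

section \<open>A fractional Sobolev inequality for functions with small support\<close>

definition gagliardo_density :: "real \<Rightarrow> real \<Rightarrow> ('a::euclidean_space \<Rightarrow> real) \<Rightarrow> 'a \<Rightarrow> ennreal" where
  "gagliardo_density s p w x =
     (\<integral>\<^sup>+y. ennreal (\<bar>w x - w y\<bar> powr p / norm (x - y) powr (real DIM('a) + s * p)) \<partial>lborel)"

definition gagliardo_energy :: "real \<Rightarrow> real \<Rightarrow> ('a::euclidean_space \<Rightarrow> real) \<Rightarrow> ennreal" where
  "gagliardo_energy s p w = (\<integral>\<^sup>+x. gagliardo_density s p w x \<partial>lborel)"

lemma gagliardo_density_measurable [measurable]:
  fixes w :: "'a::euclidean_space \<Rightarrow> real"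
  assumes [measurable]: "w \<in> borel_measurable borel"
  shows "gagliardo_density s p w \<in> borel_measurable borel"
  unfolding gagliardo_density_def by measurable

lemma gagliardo_energy_mono:
  fixes w v :: "'a::euclidean_space \<Rightarrow> real"
  assumes "p \<ge> 0" and "\<And>x y. \<bar>v x - v y\<bar> \<le> \<bar>w x - w y\<bar>"
  shows "gagliardo_energy s p v \<le> gagliardo_energy s p w"
  unfolding gagliardo_energy_def gagliardo_density_def
  by (intro nn_integral_mono ennreal_leI divide_right_mono powr_mono2) (use assms in auto)

text \<open>
  If \<open>R\<close> is the radius of a ball of volume \<open>2 * B\<close>, then \<open>R powr (N + s * p)\<close> is this constant times
  \<open>B powr (1 + s * p / N)\<close>.
\<close>

definition jump_const :: "nat \<Rightarrow> real \<Rightarrow> real \<Rightarrow> real" where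
  "jump_const N s p = (2 / unit_ball_vol (real N)) powr (1 + s * p / real N)"

text \<open>
  A ball about \<open>x\<close> of twice the volume allowed for \<open>{w > t}\<close> is at least half filled with points \<open>y\<close>
  such that \<open>w y \<le> t\<close>. Each of them contributes at least \<open>(w x - t)\<^sup>p\<close> over a fixed power of the
  radius.
\<close>

lemma jump_le_gagliardo_density:
  fixes w :: "'a::euclidean_space \<Rightarrow> real"
  assumes [measurable]: "w \<in> borel_measurable borel"
    and sp: "0 < p" "0 < s" and B: "B > 0" "emeasure lborel {y. w y > t} \<le> ennreal B"
    and x: "w x > t"
  shows "ennreal ((w x - t) powr p)
     \<le> ennreal (jump_const DIM('a) s p * B powr (s * p / real DIM('a))) * gagliardo_density s p w x"
proof -
  define N where "N = real DIM('a)"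
  define V where "V = unit_ball_vol N"
  define \<theta> where "\<theta> = s * p / N"
  have N: "N > 0" by (simp add: N_def)
  have V: "V > 0" by (simp add: V_def N_def)
  define R where "R = (2 * B / V) powr (1 / N)"
  have R: "R > 0" using B V by (simp add: R_def)
  have RN: "V * R ^ DIM('a) = 2 * B"
    using R V B N by (simp add: R_def powr_powr powr_realpow[symmetric] N_def[symmetric])
  have Rexp: "R powr (N + s * p) = (2 * B / V) powr (1 + \<theta>)"
    using N by (simp add: R_def powr_powr \<theta>_def add_divide_distrib)
  define S where "S = ball x R - {y. w y > t}"
  have [measurable]: "S \<in> sets borel" by (simp add: S_def)
  have S: "ennreal B \<le> emeasure lborel S"
  proof -
    have "ennreal (2 * B) = emeasure lborel (ball x R)"
      using R RN by (simp add: emeasure_ball V_def N_def)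
    also have "\<dots> \<le> emeasure lborel (S \<union> {y. w y > t})"
      by (intro emeasure_mono) (auto simp: S_def)
    also have "\<dots> \<le> emeasure lborel S + emeasure lborel {y. w y > t}"
      by (intro emeasure_subadditive) auto
    also have "\<dots> \<le> emeasure lborel S + ennreal B"
      using B by (intro add_mono) auto
    finally have "ennreal B + ennreal B \<le> emeasure lborel S + ennreal B"
      using B by (simp flip: ennreal_plus)
    then show ?thesis by simp
  qed
  define q where "q = (w x - t) powr p / R powr (N + s * p)"
  have q0: "q \<ge> 0" by (simp add: q_def)
  have "ennreal q * ennreal B \<le> ennreal q * emeasure lborel S"
    using S by (intro mult_left_mono) auto
  also have "\<dots> = (\<integral>\<^sup>+y. ennreal q * indicator S y \<partial>lborel)"
    by (simp add: nn_integral_cmult)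
  also have "\<dots> \<le> gagliardo_density s p w x"
    unfolding gagliardo_density_def
  proof (intro nn_integral_mono)
    fix y
    show "ennreal q * indicator S y
        \<le> ennreal (\<bar>w x - w y\<bar> powr p / norm (x - y) powr (real DIM('a) + s * p))"
    proof (cases "y \<in> S")
      case True
      then have "w y \<le> t" "norm (x - y) < R" "x \<noteq> y"
        using x by (auto simp: S_def dist_norm)
      then have "q \<le> \<bar>w x - w y\<bar> powr p / norm (x - y) powr (real DIM('a) + s * p)"
        unfolding q_def N_def using x sp N
        by (intro frac_le powr_mono2) auto
      then show ?thesis using True by (simp add: ennreal_leI)
    qed simp
  qed
  finally have main: "ennreal q * ennreal B \<le> gagliardo_density s p w x" .
  have "jump_const DIM('a) s p * B powr \<theta> * (q * B) = (w x - t) powr p"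
  proof -
    have "B powr \<theta> * B = B powr (1 + \<theta>)" using B by (simp add: powr_add)
    moreover have "R powr (N + s * p) = (2 / V) powr (1 + \<theta>) * B powr (1 + \<theta>)"
      using B V Rexp by (simp flip: powr_mult)
    moreover have "jump_const DIM('a) s p = (2 / V) powr (1 + \<theta>)"
      by (simp add: jump_const_def V_def N_def \<theta>_def)
    ultimately show ?thesis using B V by (simp add: q_def field_simps)
  qed
  then have "ennreal ((w x - t) powr p)
      = ennreal (jump_const DIM('a) s p * B powr \<theta>) * (ennreal q * ennreal B)"
    using q0 B by (simp flip: ennreal_mult add: jump_const_def)
  also have "\<dots> \<le> ennreal (jump_const DIM('a) s p * B powr \<theta>) * gagliardo_density s p w x"
    by (intro mult_left_mono main) auto
  finally show ?thesis by (simp add: \<theta>_def N_def)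
qed

text \<open>
  With \<open>t = w x / 2\<close>, the set \<open>{w > t}\<close> is bounded in volume both by the support and, by Chebyshev,
  by \<open>2\<^sup>m * I / (w x)\<^sup>m\<close>, where \<open>I = \<integral> w\<^sup>m\<close>. Splitting \<open>B powr \<theta>\<close> into \<open>B powr (\<theta> - 1 / r)\<close> and
  \<open>B powr (1 / r)\<close> and using the first bound for the former and the second for the latter produces the
  power \<open>p + m / r = m\<close> of \<open>w x\<close> on the left. Integration gives \<open>I \<le> Q * I powr (1 / r)\<close>
  with \<open>Q\<close> proportional to the energy, and \<open>I powr (1 / r)\<close> cancels because the upper bound
  \<open>T\<close> makes \<open>I\<close> finite.
\<close>

lemma fractional_sobolev_inequality_bounded:
  fixes w :: "'a::euclidean_space \<Rightarrow> real"
  assumes [measurable]: "w \<in> borel_measurable borel"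
    and w: "\<And>x. 0 \<le> w x" "\<And>x. w x \<le> T"
    and sp: "0 < p" "0 < s" and r: "1 < r" "1 / r \<le> s * p / real DIM('a)"
    and m: "m = p * r / (r - 1)"
    and a: "a > 0" "emeasure lborel {x. w x > 0} \<le> ennreal a"
    and e: "e \<ge> 0" "gagliardo_energy s p w \<le> ennreal e"
  shows "(\<integral>\<^sup>+x. ennreal (w x powr m) \<partial>lborel)
     \<le> ennreal ((2 powr m * jump_const DIM('a) s p * a powr (s * p / real DIM('a) - 1 / r) * e)
                 powr (r / (r - 1)))"
proof -
  define N where "N = real DIM('a)"
  define \<theta> where "\<theta> = s * p / N"
  define \<delta> where "\<delta> = \<theta> - 1 / r"
  define c where "c = jump_const DIM('a) s p"
  define K where "K = 2 powr m * c * a powr \<delta>"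
  have \<delta>: "\<delta> \<ge> 0" "\<theta> = \<delta> + 1 / r" using r by (auto simp: \<delta>_def \<theta>_def N_def)
  have m0: "m > 0" and mp: "p + m / r = m"
    using sp r by (auto simp: m field_simps)
  have c0: "c \<ge> 0" by (simp add: c_def jump_const_def)
  have K0: "K \<ge> 0" using c0 by (simp add: K_def)
  have T0: "T \<ge> 0" using w order_trans by blast
  define J where "J = (\<integral>\<^sup>+x. ennreal (w x powr m) \<partial>lborel)"
  have "J \<le> (\<integral>\<^sup>+x. ennreal (T powr m) * indicator {x. w x > 0} x \<partial>lborel)"
    unfolding J_def
  proof (intro nn_integral_mono)
    fix x show "ennreal (w x powr m) \<le> ennreal (T powr m) * indicator {x. w x > 0} x"
      using w[of x] m0 by (cases "w x = 0") (auto intro!: ennreal_leI powr_mono2)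
  qed
  also have "\<dots> = ennreal (T powr m) * emeasure lborel {x. w x > 0}"
    by (simp add: nn_integral_cmult)
  also have "\<dots> \<le> ennreal (T powr m) * ennreal a"
    by (intro mult_left_mono a) auto
  also have "\<dots> < \<infinity>" by (simp flip: ennreal_mult' add: ennreal_mult_less_top)
  finally have "J < \<infinity>" .
  then obtain I where I: "J = ennreal I" "I \<ge> 0" by (cases J) auto
  have "I \<le> (K * e) powr (r / (r - 1))"
  proof (cases "I = 0")
    case False
    with I have I0: "I > 0" by simp
    have pw: "ennreal (w x powr m) \<le> ennreal (K * I powr (1 / r)) * gagliardo_density s p w x" for x
    proof (cases "w x = 0")
      case False
      with w[of x] have wx: "w x > 0" by simp
      \<comment> \<open>the better of the two bounds for the volume of \<open>{w > w x / 2}\<close>\<close>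
      define B where "B = min a (2 powr m * I / w x powr m)"
      have B0: "B > 0" using a I0 wx by (simp add: B_def)
      have meas_B: "emeasure lborel {y. w y > w x / 2} \<le> ennreal B"
      proof -
        have "emeasure lborel {y. w y > w x / 2} \<le> emeasure lborel {y. w y > 0}"
          using wx by (intro emeasure_mono) auto
        then have 1: "emeasure lborel {y. w y > w x / 2} \<le> ennreal a" using a by order
        have "emeasure lborel {y. w y > w x / 2}
            = (\<integral>\<^sup>+y. indicator {y. w y > w x / 2} y \<partial>lborel)" by simp
        also have "\<dots> \<le> (\<integral>\<^sup>+y. ennreal (2 powr m / w x powr m) * ennreal (w y powr m) \<partial>lborel)"
        proof (intro nn_integral_mono)
          fix y
          show "indicator {y. w y > w x / 2} y
              \<le> ennreal (2 powr m / w x powr m) * ennreal (w y powr m)"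
          proof (cases "w y > w x / 2")
            case True
            then have "(w x / 2) powr m \<le> w y powr m"
              using wx m0 by (intro powr_mono2) auto
            then have "1 \<le> 2 powr m / w x powr m * w y powr m"
              using wx by (simp add: powr_divide field_simps)
            then have "ennreal 1 \<le> ennreal (2 powr m / w x powr m * w y powr m)"
              by (rule ennreal_leI)
            also have "\<dots> = ennreal (2 powr m / w x powr m) * ennreal (w y powr m)"
              by (rule ennreal_mult) auto
            finally show ?thesis using True by simp
          qed simp
        qed
        also have "\<dots> = ennreal (2 powr m / w x powr m) * ennreal I"
          by (simp add: nn_integral_cmult I(1)[symmetric] J_def)
        also have "\<dots> = ennreal (2 powr m * I / w x powr m)"
          using I by (simp flip: ennreal_mult)
        finally show ?thesis using 1 by (simp add: B_def min_def)
      qed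
      have "ennreal ((w x - w x / 2) powr p)
          \<le> ennreal (c * B powr \<theta>) * gagliardo_density s p w x"
        unfolding c_def \<theta>_def N_def
        using sp B0 meas_B wx by (intro jump_le_gagliardo_density) auto
      then have 2: "ennreal (2 powr p * w x powr (m / r)) * ennreal ((w x - w x / 2) powr p)
          \<le> ennreal (2 powr p * w x powr (m / r)) *
             (ennreal (c * B powr \<theta>) * gagliardo_density s p w x)"
        by (intro mult_left_mono) auto
      have 3: "2 powr p * w x powr (m / r) * ((w x - w x / 2) powr p) = w x powr m"
        using wx mp by (simp add: powr_divide flip: powr_add) (simp add: add.commute)
      have "B powr \<theta> = B powr \<delta> * B powr (1 / r)"
        by (simp add: \<delta> powr_add)
      also have "\<dots> \<le> a powr \<delta> * (2 powr m * I / w x powr m) powr (1 / r)"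
        using \<delta> B0 r by (intro mult_mono powr_mono2) (auto simp: B_def)
      also have "\<dots> = a powr \<delta> * (2 powr (m / r) * I powr (1 / r) / w x powr (m / r))"
        using I0 wx by (simp add: powr_divide powr_mult powr_powr)
      finally have "2 powr p * w x powr (m / r) * (c * B powr \<theta>)
         \<le> 2 powr p * w x powr (m / r) *
             (c * (a powr \<delta> * (2 powr (m / r) * I powr (1 / r) / w x powr (m / r))))"
        using c0 by (intro mult_left_mono) auto
      also have "\<dots> = (2 powr p * 2 powr (m / r)) * c * a powr \<delta> * I powr (1 / r)"
        using wx by (simp add: field_simps)
      also have "\<dots> = K * I powr (1 / r)"
        using mp by (simp add: K_def flip: powr_add)
      finally have 4: "2 powr p * w x powr (m / r) * (c * B powr \<theta>) \<le> K * I powr (1 / r)" .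
      have "ennreal (w x powr m)
          = ennreal (2 powr p * w x powr (m / r)) * ennreal ((w x - w x / 2) powr p)"
        unfolding 3[symmetric] by (rule ennreal_mult) auto
      also note 2
      also have "ennreal (2 powr p * w x powr (m / r)) *
             (ennreal (c * B powr \<theta>) * gagliardo_density s p w x)
           = ennreal (2 powr p * w x powr (m / r) * (c * B powr \<theta>)) * gagliardo_density s p w x"
        using c0 by (simp add: ennreal_mult' mult.assoc)
      also have "\<dots> \<le> ennreal (K * I powr (1 / r)) * gagliardo_density s p w x"
        by (intro mult_right_mono ennreal_leI 4) auto
      finally show ?thesis .
    qed (use m0 in simp)
    have "ennreal I \<le> (\<integral>\<^sup>+x. ennreal (K * I powr (1 / r)) * gagliardo_density s p w x \<partial>lborel)"
      unfolding I(1)[symmetric] J_def by (intro nn_integral_mono pw)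
    also have "\<dots> = ennreal (K * I powr (1 / r)) * gagliardo_energy s p w"
      by (simp add: nn_integral_cmult gagliardo_energy_def)
    also have "\<dots> \<le> ennreal (K * I powr (1 / r)) * ennreal e"
      by (intro mult_left_mono e) auto
    also have "\<dots> = ennreal (K * I powr (1 / r) * e)"
      using e K0 by (simp flip: ennreal_mult)
    finally have "I \<le> K * I powr (1 / r) * e"
      using e K0 by (subst (asm) ennreal_le_iff) auto
    then have "I powr (1 - 1 / r) \<le> K * e"
      using I0 by (simp add: powr_diff field_simps)
    then have "(I powr (1 - 1 / r)) powr (r / (r - 1)) \<le> (K * e) powr (r / (r - 1))"
      using r by (intro powr_mono2) auto
    moreover have "(1 - 1 / r) * (r / (r - 1)) = 1" using r by (simp add: field_simps)
    then have "(I powr (1 - 1 / r)) powr (r / (r - 1)) = I"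
      using I0 by (simp only: powr_powr) simp
    ultimately show ?thesis by simp
  qed simp
  then have "J \<le> ennreal ((K * e) powr (r / (r - 1)))"
    unfolding I(1) by (rule ennreal_leI)
  then show ?thesis by (simp add: J_def K_def c_def \<delta>_def \<theta>_def N_def)
qed

text \<open>
  The estimate for bounded functions is uniform in \<open>T\<close>, and truncation increases neither support nor
  energy, so monotone convergence removes the boundedness.
\<close>

lemma fractional_sobolev_inequality:
  fixes w :: "'a::euclidean_space \<Rightarrow> real"
  assumes [measurable]: "w \<in> borel_measurable borel"
    and w: "\<And>x. 0 \<le> w x"
    and sp: "0 < p" "0 < s" and r: "1 < r" "1 / r \<le> s * p / real DIM('a)"
    and m: "m = p * r / (r - 1)"
    and a: "a > 0" "emeasure lborel {x. w x > 0} \<le> ennreal a"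
    and e: "e \<ge> 0" "gagliardo_energy s p w \<le> ennreal e"
  shows "(\<integral>\<^sup>+x. ennreal (w x powr m) \<partial>lborel)
     \<le> ennreal ((2 powr m * jump_const DIM('a) s p * a powr (s * p / real DIM('a) - 1 / r) * e)
                 powr (r / (r - 1)))" (is "_ \<le> ?R")
proof -
  have m0: "m > 0" using sp r by (simp add: m)
  define v where "v n x = min (w x) (real n)" for n x
  have [measurable]: "v n \<in> borel_measurable borel" for n unfolding v_def by measurable
  have v_bound: "(\<integral>\<^sup>+x. ennreal (v n x powr m) \<partial>lborel) \<le> ?R" for n
  proof (rule fractional_sobolev_inequality_bounded[where T = "real n"])
    have "emeasure lborel {x. v n x > 0} \<le> emeasure lborel {x. w x > 0}"
      by (intro emeasure_mono) (auto simp: v_def)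
    then show "emeasure lborel {x. v n x > 0} \<le> ennreal a" using a by order
    have "gagliardo_energy s p (v n) \<le> gagliardo_energy s p w"
      using sp by (intro gagliardo_energy_mono) (auto simp: v_def)
    then show "gagliardo_energy s p (v n) \<le> ennreal e" using e by order
  qed (use assms in \<open>auto simp: v_def\<close>)
  have "(\<integral>\<^sup>+x. ennreal (w x powr m) \<partial>lborel) = (\<integral>\<^sup>+x. (SUP n. ennreal (v n x powr m)) \<partial>lborel)"
  proof (intro nn_integral_cong antisym)
    fix x
    obtain n where "w x \<le> real n" using real_arch_simple by blast
    then have "ennreal (w x powr m) = ennreal (v n x powr m)" by (simp add: v_def)
    then show "ennreal (w x powr m) \<le> (SUP n. ennreal (v n x powr m))"
      by (auto intro: SUP_upper2[of n])
    show "(SUP n. ennreal (v n x powr m)) \<le> ennreal (w x powr m)"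
      using w[of x] m0 by (intro SUP_least ennreal_leI powr_mono2) (auto simp: v_def)
  qed
  also have "\<dots> = (SUP n. \<integral>\<^sup>+x. ennreal (v n x powr m) \<partial>lborel)"
  proof (intro nn_integral_monotone_convergence_SUP)
    show "incseq (\<lambda>n x. ennreal (v n x powr m))"
      using w m0 by (auto simp: incseq_def le_fun_def v_def intro!: ennreal_leI powr_mono2)
  qed simp
  also have "\<dots> \<le> ?R" by (intro SUP_least v_bound)
  finally show ?thesis .
qed

section \<open>Decay of superlevel sets\<close>

text \<open>
  Along the levels \<open>k\<^sub>j = K * (2 - 2\<^sup>-\<^sup>j)\<close> the factor \<open>(k / (l - k))\<^sup>m\<close> grows only geometrically,
  with ratio \<open>b = 2\<^sup>m\<close>. If \<open>a (k\<^sub>j)\<close> decays with ratio \<open>\<eta> = b powr (- 1 / \<gamma>)\<close>, the extra power \<open>\<gamma>\<close> in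
  the recursion yields \<open>b\<^sup>-\<^sup>j\<close>, just enough to offset this growth; the decay propagates once
  \<open>a K\<close> is small.
\<close>

lemma fast_decay_imp_zero:
  fixes a :: "real \<Rightarrow> real"
  assumes nonneg: "\<And>k. a k \<ge> 0"
    and antimono: "\<And>k l. k0 \<le> k \<Longrightarrow> k \<le> l \<Longrightarrow> a l \<le> a k"
    and const: "D \<ge> 0" "m > 0" "\<gamma> > 0"
    and decay: "\<And>k l. k0 \<le> k \<Longrightarrow> k < l \<Longrightarrow> a l \<le> D * (k / (l - k)) powr m * a k powr (1 + \<gamma>)"
    and lim: "(a \<longlongrightarrow> 0) at_top"
  shows "\<exists>K \<ge> k0. a K = 0"
proof -
  define b where "b = (2::real) powr m"
  define D' where "D' = D * 4 powr m + 1"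
  define \<eta> where "\<eta> = b powr (- 1 / \<gamma>)"
  have b: "b > 1" using const by (simp add: b_def)
  have D': "D' > 0" using const by (simp add: D'_def add_nonneg_pos)
  have \<eta>: "\<eta> > 0" "\<eta> < 1" using b const by (auto simp: \<eta>_def powr_less_one)
  have \<eta>\<gamma>: "\<eta> powr \<gamma> = 1 / b" using const b unfolding \<eta>_def powr_powr by (simp add: powr_minus_divide)
  \<comment> \<open>the threshold for \<open>a K\<close> that makes the first step contract by \<open>\<eta>\<close>\<close>
  define \<epsilon> where "\<epsilon> = (\<eta> / D') powr (1 / \<gamma>)"
  have \<epsilon>: "\<epsilon> > 0" using \<eta> D' by (simp add: \<epsilon>_def)
  have "eventually (\<lambda>k. a k < \<epsilon> \<and> k \<ge> max k0 1) at_top"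
    using order_tendstoD(2)[OF lim \<epsilon>] eventually_ge_at_top by (rule eventually_conj)
  then obtain K where K: "a K < \<epsilon>" "K \<ge> k0" "K \<ge> 1"
    by (auto simp: eventually_at_top_linorder)
  have start: "D' * a K powr \<gamma> \<le> \<eta>"
  proof -
    have "a K powr \<gamma> \<le> \<epsilon> powr \<gamma>" using K nonneg const by (intro powr_mono2) auto
    also have "\<dots> = \<eta> / D'" using const \<eta> D' by (simp add: \<epsilon>_def powr_powr)
    finally show ?thesis using D' by (simp add: field_simps)
  qed
  define k where "k j = K * (2 - (1 / 2) ^ j)" for j :: nat
  have geom: "a (k j) \<le> a K * \<eta> ^ j" for j
  proof (induction j)
    case 0 then show ?case by (simp add: k_def)
  next
    case (Suc j)
    have kj: "k j \<ge> K" "k j < k (Suc j)" "k (Suc j) - k j = K * (1 / 2) ^ Suc j"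
      using K power_le_one[of "1/2::real" j] by (auto simp: k_def algebra_simps)
    have "k j / (k (Suc j) - k j) = (2 - (1 / 2) ^ j) * (2 * 2 ^ j)"
      unfolding kj(3) using K by (simp add: k_def field_simps power_divide)
    also have "\<dots> \<le> 2 * (2 * 2 ^ j)" by (intro mult_right_mono) auto
    also have "2 * (2 * 2 ^ j) = (4 * 2 ^ j :: real)" by simp
    finally have quot: "k j / (k (Suc j) - k j) \<le> 4 * 2 ^ j" .
    have quot': "(k j / (k (Suc j) - k j)) powr m \<le> 4 powr m * b ^ j"
    proof -
      have "(k j / (k (Suc j) - k j)) powr m \<le> (4 * 2 ^ j) powr m"
        using quot kj(1,2) K const by (intro powr_mono2) auto
      also have "\<dots> = 4 powr m * b ^ j"
        by (simp add: powr_mult b_def powr_power mult.commute flip: powr_realpow powr_powr)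
           (simp add: powr_powr mult.commute)
      finally show ?thesis .
    qed
    have aj: "a (k j) powr \<gamma> \<le> a K powr \<gamma> / b ^ j"
    proof -
      have "a (k j) powr \<gamma> \<le> (a K * \<eta> ^ j) powr \<gamma>"
        using Suc.IH nonneg const by (intro powr_mono2) auto
      also have "\<dots> = a K powr \<gamma> * (\<eta> powr \<gamma>) ^ j"
        using \<eta> nonneg[of K] by (simp add: powr_mult powr_power mult.commute flip: powr_realpow)
           (simp add: powr_powr mult.commute)
      finally show ?thesis by (simp add: \<eta>\<gamma> power_divide)
    qed
    have "a (k (Suc j)) \<le> D * (k j / (k (Suc j) - k j)) powr m * a (k j) powr (1 + \<gamma>)"
      using kj K by (intro decay) auto
    also have "\<dots> = D * (k j / (k (Suc j) - k j)) powr m * (a (k j) powr \<gamma> * a (k j))"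
      using nonneg[of "k j"] by (simp add: powr_add)
    also have "\<dots> \<le> D * (4 powr m * b ^ j) * (a K powr \<gamma> / b ^ j * a (k j))"
      using const nonneg b by (intro mult_mono mult_left_mono mult_right_mono quot' aj) auto
    also have "\<dots> = (D * 4 powr m * a K powr \<gamma>) * a (k j)" using b by simp
    also have "\<dots> \<le> (D' * a K powr \<gamma>) * a (k j)"
      using nonneg by (intro mult_right_mono) (auto simp: D'_def)
    also have "\<dots> \<le> \<eta> * (a K * \<eta> ^ j)"
      using nonneg \<eta> by (intro mult_mono start Suc.IH) auto
    finally show ?case by (simp add: mult_ac)
  qed
  have "a (2 * K) \<le> a K * \<eta> ^ j" for j
  proof -
    have "k j \<le> 2 * K" "K \<le> k j" using K power_le_one[of "1/2::real" j] by (auto simp: k_def)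
    then have "a (2 * K) \<le> a (k j)" using K by (intro antimono) auto
    with geom show ?thesis by (rule order_trans[rotated])
  qed
  moreover have "(\<lambda>j. a K * \<eta> ^ j) \<longlonglongrightarrow> a K * 0"
    using \<eta> by (intro tendsto_mult tendsto_const LIMSEQ_realpow_zero) auto
  ultimately have "a (2 * K) \<le> a K * 0"
    by (intro LIMSEQ_le_const) auto
  with nonneg[of "2 * K"] show ?thesis using K by (intro exI[of _ "2 * K"]) simp
qed

section \<open>Lebesgue measure on the product space\<close>

lemma null_cylinders:
  fixes N :: "'a::euclidean_space set"
  assumes "N \<in> null_sets lborel"
  shows "N \<times> (UNIV :: 'a set) \<in> null_sets lborel" "(UNIV :: 'a set) \<times> N \<in> null_sets lborel"
proof -
  from assms have [measurable]: "N \<in> sets borel" and N: "emeasure lborel N = 0" by auto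
  have *: "emeasure (lborel \<Otimes>\<^sub>M lborel) (A \<times> B) = emeasure lborel A * emeasure lborel B"
    if "A \<in> sets borel" "B \<in> sets borel" for A B :: "'a set"
    using that by (intro lborel.emeasure_pair_measure_Times) auto
  have "emeasure lborel (N \<times> (UNIV :: 'a set)) = 0"
       "emeasure lborel ((UNIV :: 'a set) \<times> N) = 0"
    using N *[of N UNIV] *[of UNIV N] by (simp_all add: lborel_prod)
  moreover have "N \<times> (UNIV :: 'a set) \<in> sets lborel" "(UNIV :: 'a set) \<times> N \<in> sets lborel"
    by (simp_all add: borel_Times)
  ultimately show "N \<times> (UNIV :: 'a set) \<in> null_sets lborel" "(UNIV :: 'a set) \<times> N \<in> null_sets lborel"
    by auto
qed

text \<open>
  Preimages of null sets under the projections are null cylinders. This makes the projections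
  measurable between the completed \<open>\<sigma>\<close>-algebras, so that an expression in \<open>u (fst z)\<close> and
  \<open>u (snd z)\<close> is measurable for a function \<open>u\<close> that is only Lebesgue measurable.
\<close>

lemma measurable_lebesgue_fst_snd:
  "(fst :: 'a::euclidean_space \<times> 'a \<Rightarrow> 'a) \<in> measurable lebesgue lebesgue"
  "(snd :: 'a::euclidean_space \<times> 'a \<Rightarrow> 'a) \<in> measurable lebesgue lebesgue"
proof -
  have m: "(fst :: 'a \<times> 'a \<Rightarrow> 'a) \<in> borel_measurable lebesgue"
       "(snd :: 'a \<times> 'a \<Rightarrow> 'a) \<in> borel_measurable lebesgue"
    by (auto intro!: measurable_completion borel_measurable_continuous_onI continuous_intros)
  then have m': "(fst :: 'a \<times> 'a \<Rightarrow> 'a) \<in> measurable lebesgue lborel"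
       "(snd :: 'a \<times> 'a \<Rightarrow> 'a) \<in> measurable lebesgue lborel"
    by simp_all
  have "N \<in> null_sets (distr lebesgue lborel (fst :: 'a \<times> 'a \<Rightarrow> 'a)) \<and>
        N \<in> null_sets (distr lebesgue lborel (snd :: 'a \<times> 'a \<Rightarrow> 'a))"
    if N: "N \<in> null_sets lborel" for N :: "'a set"
  proof -
    have "fst -` N = N \<times> (UNIV :: 'a set)" "snd -` N = (UNIV :: 'a set) \<times> N" by auto
    then show ?thesis
      using null_cylinders[OF N] N m by (auto simp: null_sets_def emeasure_distr)
  qed
  then show "(fst :: 'a \<times> 'a \<Rightarrow> 'a) \<in> measurable lebesgue lebesgue"
            "(snd :: 'a \<times> 'a \<Rightarrow> 'a) \<in> measurable lebesgue lebesgue"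
    using m' by (auto intro!: completion.measurable_completion2)
qed

lemma AE_lebesgue_prod:
  fixes P :: "'a::euclidean_space \<Rightarrow> bool"
  assumes "AE x in lebesgue. P x"
  shows "AE z in (lebesgue :: ('a \<times> 'a) measure). P (fst z) \<and> P (snd z)"
proof -
  from assms have "AE x in lborel. P x" by (simp add: AE_completion_iff)
  then obtain N where N: "{x \<in> space lborel. \<not> P x} \<subseteq> N" "N \<in> null_sets lborel"
    unfolding eventually_ae_filter by blast
  then have "N \<times> UNIV \<union> UNIV \<times> N \<in> null_sets (lborel :: ('a \<times> 'a) measure)"
    using null_cylinders by blast
  moreover have "{z \<in> space lborel. \<not> (P (fst z) \<and> P (snd z))} \<subseteq> N \<times> UNIV \<union> UNIV \<times> N"
    using N by auto
  ultimately have "AE z in (lborel :: ('a \<times> 'a) measure). P (fst z) \<and> P (snd z)"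
    by (rule AE_I')
  then show ?thesis by (rule AE_completion)
qed

lemma gagliardo_energy_eq_prod:
  fixes w :: "'a::euclidean_space \<Rightarrow> real"
  assumes [measurable]: "w \<in> borel_measurable borel"
  shows "gagliardo_energy s p w = (\<integral>\<^sup>+z. ennreal (\<bar>w (fst z) - w (snd z)\<bar> powr p /
            norm (fst z - snd z) powr (real DIM('a) + s * p)) \<partial>(lebesgue :: ('a \<times> 'a) measure))"
proof -
  have "(\<lambda>z. ennreal (\<bar>w (fst z) - w (snd z)\<bar> powr p /
            norm (fst z - snd z) powr (real DIM('a) + s * p))) \<in> borel_measurable (lborel \<Otimes>\<^sub>M lborel)"
    by measurable
  from lborel.nn_integral_fst[OF this] show ?thesis
    by (simp add: gagliardo_energy_def gagliardo_density_def nn_integral_completion lborel_prod)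
qed

section \<open>Truncations as test functions\<close>

text \<open>
  The increment \<open>e\<close> of the truncation never has the sign opposite to the increment \<open>d\<close> of the
  function and satisfies \<open>\<bar>e\<bar> \<le> \<bar>d\<bar>\<close>. Hence \<open>\<bar>e\<bar>\<^sup>p \<le> \<bar>d\<bar>\<^sup>p\<^sup>-\<^sup>1 * \<bar>e\<bar>\<close>, and \<open>\<bar>d\<bar>\<^sup>p\<^sup>-\<^sup>2 * d * e = \<bar>d\<bar>\<^sup>p\<^sup>-\<^sup>1 * \<bar>e\<bar>\<close>.
\<close>

lemma truncation_coercive:
  fixes a b k p :: real
  assumes "p > 1"
  shows "\<bar>max (a - k) 0 - max (b - k) 0\<bar> powr p
     \<le> \<bar>a - b\<bar> powr (p - 2) * (a - b) * (max (a - k) 0 - max (b - k) 0)"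
proof (cases "a = b")
  case False
  define d e where "d = a - b" and "e = max (a - k) 0 - max (b - k) 0"
  have d: "d \<noteq> 0" "\<bar>e\<bar> \<le> \<bar>d\<bar>" using False by (auto simp: d_def e_def)
  have de: "d * e = \<bar>d\<bar> * \<bar>e\<bar>"
    unfolding abs_mult[symmetric] by (rule abs_of_nonneg[symmetric])
      (auto simp: d_def e_def max_def zero_le_mult_iff)
  have "\<bar>e\<bar> powr p = \<bar>e\<bar> powr (p - 1) * \<bar>e\<bar>"
    using assms powr_add[of "\<bar>e\<bar>" "p - 1" 1] by simp
  also have "\<dots> \<le> \<bar>d\<bar> powr (p - 1) * \<bar>e\<bar>"
    using d assms by (intro mult_right_mono powr_mono2) auto
  also have "\<bar>d\<bar> powr (p - 1) = \<bar>d\<bar> powr (p - 2) * \<bar>d\<bar>"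
    using powr_add[of "\<bar>d\<bar>" "p - 2" 1] by simp
  also have "\<bar>d\<bar> powr (p - 2) * \<bar>d\<bar> * \<bar>e\<bar> = \<bar>d\<bar> powr (p - 2) * d * e"
    using de by (simp add: mult.assoc)
  finally show ?thesis by (simp add: d_def e_def)
qed simp

lemma powr_minus_two_mult_le:
  fixes d e p :: real
  assumes "\<bar>e\<bar> \<le> \<bar>d\<bar>" "p > 0"
  shows "\<bar>\<bar>d\<bar> powr (p - 2) * d * e\<bar> \<le> \<bar>d\<bar> powr p"
proof (cases "d = 0")
  case False
  have "\<bar>\<bar>d\<bar> powr (p - 2) * d * e\<bar> = \<bar>d\<bar> powr (p - 2) * \<bar>d\<bar> * \<bar>e\<bar>" by (simp add: abs_mult)
  also have "\<dots> \<le> \<bar>d\<bar> powr (p - 2) * \<bar>d\<bar> * \<bar>d\<bar>"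
    using assms by (intro mult_left_mono) auto
  also have "\<dots> = \<bar>d\<bar> powr p"
    using powr_add[of "\<bar>d\<bar>" "p - 2" 1] powr_add[of "\<bar>d\<bar>" "p - 1" 1] by simp
  finally show ?thesis .
qed simp

text \<open>
  \<open>u0\<close> is a Borel representative of \<open>u\<close>; Tonelli's theorem and the Sobolev inequality are applied to
  its truncations.
\<close>

context
  fixes s p :: real and \<Omega> :: "'a::euclidean_space set" and u u0 :: "'a \<Rightarrow> real"
  assumes p: "p > 1"
    and u: "u \<in> fractional_sobolev0 s p \<Omega>"
    and u0 [measurable]: "u0 \<in> borel_measurable borel"
    and eq: "AE x in lebesgue. u x = u0 x"
begin

lemma truncation_energy_finite:
  "gagliardo_energy s p (\<lambda>x. max (u0 x - k) 0) < \<infinity>"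
proof -
  have "gagliardo_energy s p (\<lambda>x. max (u0 x - k) 0) \<le> gagliardo_energy s p u0"
    using p by (intro gagliardo_energy_mono) auto
  also have "\<dots> = (\<integral>\<^sup>+z. ennreal (\<bar>u (fst z) - u (snd z)\<bar> powr p /
            norm (fst z - snd z) powr (real DIM('a) + s * p)) \<partial>(lebesgue :: ('a \<times> 'a) measure))"
    unfolding gagliardo_energy_eq_prod[OF u0]
    by (intro nn_integral_cong_AE eventually_mono[OF AE_lebesgue_prod[OF eq]]) auto
  also have "\<dots> < \<infinity>"
    using u by (auto simp: fractional_sobolev0_def fractional_sobolev_def integrable_iff_bounded case_prod_beta)
  finally show ?thesis .
qed

lemma truncation_admissible:
  assumes k: "k \<ge> 0"
  shows "(\<lambda>x. max (u0 x - k) 0) \<in> fractional_sobolev0 s p \<Omega>"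
proof -
  define v where "v = (\<lambda>x. max (u0 x - k) 0)"
  have v [measurable]: "v \<in> borel_measurable borel" unfolding v_def by measurable
  have "integrable lebesgue (\<lambda>x. \<bar>v x\<bar> powr p)"
  proof (rule Bochner_Integration.integrable_bound)
    show "integrable lebesgue (\<lambda>x. \<bar>u x\<bar> powr p)"
      using u by (simp add: fractional_sobolev0_def fractional_sobolev_def Lp_space_def)
    show "(\<lambda>x. \<bar>v x\<bar> powr p) \<in> borel_measurable lebesgue"
      by (rule measurable_completion) measurable
    show "AE x in lebesgue. norm (\<bar>v x\<bar> powr p) \<le> norm (\<bar>u x\<bar> powr p)"
      using eq by eventually_elim (use k p in \<open>auto simp: v_def intro!: powr_mono2\<close>)
  qed
  moreover have "v \<in> borel_measurable lebesgue" by (rule measurable_completion) measurable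
  moreover have "integrable (lebesgue :: ('a \<times> 'a) measure)
          (\<lambda>(x, y). \<bar>v x - v y\<bar> powr p / norm (x - y) powr (real DIM('a) + s * p))"
  proof (subst integrable_iff_bounded, intro conjI)
    have "(\<lambda>z. \<bar>v (fst z) - v (snd z)\<bar> powr p / norm (fst z - snd z) powr (real DIM('a) + s * p))
         \<in> borel_measurable (borel \<Otimes>\<^sub>M borel)"
      by measurable
    then show "(\<lambda>(x, y). \<bar>v x - v y\<bar> powr p / norm (x - y) powr (real DIM('a) + s * p))
         \<in> borel_measurable (lebesgue :: ('a \<times> 'a) measure)"
      by (intro measurable_completion) (simp add: borel_prod case_prod_beta)
    show "(\<integral>\<^sup>+z. ennreal (norm (case z of (x, y) \<Rightarrow>
             \<bar>v x - v y\<bar> powr p / norm (x - y) powr (real DIM('a) + s * p)))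
             \<partial>(lebesgue :: ('a \<times> 'a) measure)) < \<infinity>"
      using truncation_energy_finite[of k]
      unfolding v_def[symmetric] gagliardo_energy_eq_prod[OF v] by (simp add: case_prod_beta)
  qed
  moreover have "AE x in lebesgue. x \<notin> \<Omega> \<longrightarrow> u x = 0"
    using u by (simp add: fractional_sobolev0_def)
  with eq have "AE x in lebesgue. x \<notin> \<Omega> \<longrightarrow> v x = 0"
    by eventually_elim (use k in \<open>auto simp: v_def\<close>)
  ultimately show ?thesis
    unfolding v_def[symmetric] by (simp add: fractional_sobolev0_def fractional_sobolev_def Lp_space_def)
qed

text \<open>
  The truncation is used as a test function: the left-hand side of the weak formulation
  dominates its energy, and in the integral with \<open>h\<close> the test function is at most \<open>\<bar>u\<bar>\<close> and vanishes off \<open>{u > k}\<close>. The integral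
  on the right-hand side may be infinite.
\<close>

lemma caccioppoli:
  assumes sol: "weak_solution s p \<Omega> h lam u" and k: "k \<ge> 0" and \<Omega>: "\<Omega> \<in> sets lebesgue"
  shows "gagliardo_energy s p (\<lambda>x. max (u0 x - k) 0)
    \<le> ennreal \<bar>lam\<bar> * (\<integral>\<^sup>+x. ennreal (\<bar>h x\<bar> * (if u x > k then \<bar>u x\<bar> powr p else 0)) \<partial>lebesgue_on \<Omega>)"
proof -
  define v where "v = (\<lambda>x. max (u0 x - k) 0)"
  have v [measurable]: "v \<in> borel_measurable borel" unfolding v_def by measurable
  define L where "L = (\<lambda>z. \<bar>u (fst z) - u (snd z)\<bar> powr (p - 2) * (u (fst z) - u (snd z)) *
      (v (fst z) - v (snd z)) / norm (fst z - snd z) powr (real DIM('a) + s * p))"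
  define R where "R = (\<lambda>x. h x * \<bar>u x\<bar> powr (p - 2) * u x * v x)"
  have weak: "integral\<^sup>L (lebesgue :: ('a \<times> 'a) measure) L = lam * integral\<^sup>L (lebesgue_on \<Omega>) R"
    using bspec[OF conjunct2[OF sol[unfolded weak_solution_def]] truncation_admissible[OF k]]
    by (simp add: L_def R_def v_def case_prod_unfold)
  have um: "u \<in> borel_measurable lebesgue"
    using u by (simp add: fractional_sobolev0_def fractional_sobolev_def Lp_space_def)
  note [measurable] = measurable_compose[OF measurable_lebesgue_fst_snd(1) um]
    measurable_compose[OF measurable_lebesgue_fst_snd(2) um]
    measurable_compose[OF measurable_lebesgue_fst_snd(1) measurable_completion[of v]]
    measurable_compose[OF measurable_lebesgue_fst_snd(2) measurable_completion[of v]]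
  have norm_meas [measurable]:
    "(\<lambda>z. norm (fst z - snd z)) \<in> borel_measurable (lebesgue :: ('a \<times> 'a) measure)"
    by (intro measurable_completion) (auto intro!: borel_measurable_continuous_onI continuous_intros)
  have "integrable lebesgue L"
  proof (rule Bochner_Integration.integrable_bound)
    show "integrable (lebesgue :: ('a \<times> 'a) measure)
          (\<lambda>(x, y). \<bar>u x - u y\<bar> powr p / norm (x - y) powr (real DIM('a) + s * p))"
      using u by (simp add: fractional_sobolev0_def fractional_sobolev_def)
    show "L \<in> borel_measurable lebesgue" unfolding L_def by measurable
    show "AE z in lebesgue. norm (L z) \<le> norm (case z of (x, y) \<Rightarrow>
            \<bar>u x - u y\<bar> powr p / norm (x - y) powr (real DIM('a) + s * p))"
      using AE_lebesgue_prod[OF eq]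
    proof eventually_elim
      case (elim z)
      then have "\<bar>v (fst z) - v (snd z)\<bar> \<le> \<bar>u (fst z) - u (snd z)\<bar>" by (auto simp: v_def)
      from powr_minus_two_mult_le[OF this, of p] p show ?case
        by (auto simp: L_def case_prod_beta abs_mult intro!: divide_right_mono)
    qed
  qed
  have coercive: "AE z in lebesgue. \<bar>v (fst z) - v (snd z)\<bar> powr p /
       norm (fst z - snd z) powr (real DIM('a) + s * p) \<le> L z"
    using AE_lebesgue_prod[OF eq]
  proof eventually_elim
    case (elim z)
    then show ?case using truncation_coercive[OF p, of "u0 (fst z)" k "u0 (snd z)"]
      unfolding L_def v_def by (intro divide_right_mono) auto
  qed
  have "gagliardo_energy s p v \<le> (\<integral>\<^sup>+z. ennreal (L z) \<partial>lebesgue)"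
    unfolding gagliardo_energy_eq_prod[OF v]
    by (intro nn_integral_mono_AE eventually_mono[OF coercive] ennreal_leI)
  also have "\<dots> = ennreal (integral\<^sup>L lebesgue L)"
  proof (rule nn_integral_eq_integral[OF \<open>integrable lebesgue L\<close>])
    show "AE z in lebesgue. 0 \<le> L z"
      using coercive by eventually_elim (meson divide_nonneg_nonneg order_trans powr_ge_zero)
  qed
  also have "\<dots> \<le> ennreal (\<bar>lam\<bar> * norm (integral\<^sup>L (lebesgue_on \<Omega>) R))"
    unfolding weak by (intro ennreal_leI) (metis abs_ge_self abs_mult real_norm_def)
  also have "\<dots> = ennreal \<bar>lam\<bar> * ennreal (norm (integral\<^sup>L (lebesgue_on \<Omega>) R))"
    by (simp add: ennreal_mult)
  \<comment> \<open>if \<open>R\<close> is not integrable, its integral is \<open>0\<close> by convention and the bound is trivial\<close>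
  also have "ennreal (norm (integral\<^sup>L (lebesgue_on \<Omega>) R)) \<le> (\<integral>\<^sup>+x. ennreal (norm (R x)) \<partial>lebesgue_on \<Omega>)"
    by (cases "integrable (lebesgue_on \<Omega>) R")
      (auto simp: not_integrable_integral_eq dest!: integral_norm_bound_ennreal)
  also have "\<dots> \<le> (\<integral>\<^sup>+x. ennreal (\<bar>h x\<bar> * (if u x > k then \<bar>u x\<bar> powr p else 0)) \<partial>lebesgue_on \<Omega>)"
  proof (intro nn_integral_mono_AE)
    have "AE x in lebesgue_on \<Omega>. u x = u0 x"
      using \<Omega> by (subst AE_restrict_space_iff) (auto intro: eventually_mono[OF eq])
    then show "AE x in lebesgue_on \<Omega>.
        ennreal (norm (R x)) \<le> ennreal (\<bar>h x\<bar> * (if u x > k then \<bar>u x\<bar> powr p else 0))"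
    proof eventually_elim
      case (elim x)
      show ?case
      proof (intro ennreal_leI)
        have "\<bar>\<bar>u x\<bar> powr (p - 2) * u x * v x\<bar> \<le> (if u x > k then \<bar>u x\<bar> powr p else 0)"
        proof (cases "u x > k")
          case True
          then have "\<bar>v x\<bar> \<le> \<bar>u x\<bar>" using elim k by (simp add: v_def)
          from powr_minus_two_mult_le[OF this, of p] show ?thesis using p True by simp
        qed (use elim in \<open>simp add: v_def\<close>)
        then have "\<bar>h x\<bar> * \<bar>\<bar>u x\<bar> powr (p - 2) * u x * v x\<bar>
            \<le> \<bar>h x\<bar> * (if u x > k then \<bar>u x\<bar> powr p else 0)" by (intro mult_left_mono) auto
        then show "norm (R x) \<le> \<bar>h x\<bar> * (if u x > k then \<bar>u x\<bar> powr p else 0)"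
          by (simp add: R_def abs_mult mult.assoc)
      qed
    qed
  qed
  finally show ?thesis by (simp add: v_def mult_left_mono)
qed

end

section \<open>Boundedness of weak solutions\<close>

text \<open>
  For \<open>s * p < N\<close> the quotient of \<open>p\<close> by the critical exponent is \<open>1 - s * p / N\<close>; otherwise
  \<open>1 / r < 1 \<le> s * p / N\<close>.
\<close>

lemma weight_exponent_bound:
  assumes "p > 0" "s > 0" "N > 0" "r > 1"
    and "ereal (1 / r) + ereal p / critical_exponent N s p < 1"
  shows "1 / r < s * p / real N"
proof (cases "s * p < real N")
  case True
  have "ereal (1 / r) + ereal p / critical_exponent N s p
      = ereal (1 / r + p / (real N * p / (real N - s * p)))"
    using True assms by (simp add: critical_exponent_def)
  also have "p / (real N * p / (real N - s * p)) = 1 - s * p / real N"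
    using True assms by (simp add: field_simps)
  finally show ?thesis using assms by simp
next
  case False
  then have "1 \<le> s * p / real N" using assms by simp
  moreover have "1 / r < 1" using assms by simp
  ultimately show ?thesis by linarith
qed

text \<open>
  De Giorgi's argument. The Sobolev inequality is used twice for each level: with any finite
  bound for the energy, to see that \<open>I = \<integral> (u - k)\<^sup>+\<^sup>m\<close> is finite, and then with the bound
  coming from the equation. The right-hand side of the latter contains \<open>I\<close> again with a small factor, and
  finiteness allows this term to be absorbed.
\<close>

lemma weak_solution_bounded_above:
  fixes u :: "'a::euclidean_space \<Rightarrow> real"
  assumes p: "p > 1" and s: "s > 0" and \<Omega>: "\<Omega> \<in> sets lebesgue"
    and h: "h \<in> weight_class s p \<Omega> p"
    and sol: "weak_solution s p \<Omega> h lam u"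
  shows "\<exists>K. AE x in lebesgue. u x \<le> K"
proof -
  define N where "N = real DIM('a)"
  define \<theta> where "\<theta> = s * p / N"
  obtain r where r: "r > 1" "h \<in> Lp_space (lebesgue_on \<Omega>) r"
    and "ereal (1 / r) + ereal p / critical_exponent DIM('a) s p < 1"
    using h by (auto simp: weight_class_def)
  then have r\<theta>: "1 / r < \<theta>"
    using weight_exponent_bound[of p s "DIM('a)" r] p s by (simp add: \<theta>_def N_def)
  define q where "q = r / (r - 1)"
  define m where "m = p * q"
  have q: "q > 1" "1 / r + 1 / q = 1" using r by (auto simp: q_def field_simps)
  have m: "m > 0" "m = p * r / (r - 1)" using p q(1) by (simp add: m_def) (simp add: m_def q_def)
  define \<gamma> where "\<gamma> = (\<theta> - 1 / r) * q"
  have \<gamma>: "\<gamma> > 0" using r\<theta> q by (simp add: \<gamma>_def)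

  have um: "u \<in> borel_measurable lebesgue" and usob: "u \<in> fractional_sobolev0 s p \<Omega>"
    and up: "integrable lebesgue (\<lambda>x. \<bar>u x\<bar> powr p)"
    using sol by (auto simp: weak_solution_def fractional_sobolev0_def fractional_sobolev_def Lp_space_def)
  obtain u0 where u0 [measurable]: "u0 \<in> borel_measurable borel" and eq0: "AE x in lborel. u x = u0 x"
    using completion_ex_borel_measurable_real[OF um] by auto
  have eq: "AE x in lebesgue. u x = u0 x" using eq0 by (rule AE_completion)

  \<comment> \<open>the summand \<open>1\<close> makes \<open>H\<close> positive even if \<open>h\<close> vanishes almost everywhere\<close>
  define H where "H = (\<integral>x. \<bar>h x\<bar> powr r \<partial>lebesgue_on \<Omega>) + 1"
  have hm [measurable]: "h \<in> borel_measurable (lebesgue_on \<Omega>)" using r by (simp add: Lp_space_def)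
  have H: "H > 0" "(\<integral>\<^sup>+x. ennreal (\<bar>h x\<bar> powr r) \<partial>lebesgue_on \<Omega>) \<le> ennreal H"
  proof -
    have "(\<integral>\<^sup>+x. ennreal (\<bar>h x\<bar> powr r) \<partial>lebesgue_on \<Omega>)
        = ennreal (\<integral>x. \<bar>h x\<bar> powr r \<partial>lebesgue_on \<Omega>)"
      using r by (intro nn_integral_eq_integral) (auto simp: Lp_space_def)
    then show "(\<integral>\<^sup>+x. ennreal (\<bar>h x\<bar> powr r) \<partial>lebesgue_on \<Omega>) \<le> ennreal H"
      by (simp add: H_def ennreal_leI)
    show "H > 0" unfolding H_def by (intro add_nonneg_pos Bochner_Integration.integral_nonneg) auto
  qed

  define P where "P = (\<integral>x. \<bar>u x\<bar> powr p \<partial>lebesgue)"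
  have P: "P \<ge> 0" "(\<integral>\<^sup>+x. ennreal (\<bar>u0 x\<bar> powr p) \<partial>lborel) \<le> ennreal P"
  proof -
    have "(\<integral>\<^sup>+x. ennreal (\<bar>u0 x\<bar> powr p) \<partial>lborel) = (\<integral>\<^sup>+x. ennreal (\<bar>u x\<bar> powr p) \<partial>lebesgue)"
      unfolding nn_integral_completion by (intro nn_integral_cong_AE eventually_mono[OF eq0]) auto
    also have "\<dots> = ennreal P"
      unfolding P_def by (intro nn_integral_eq_integral up) auto
    finally show "(\<integral>\<^sup>+x. ennreal (\<bar>u0 x\<bar> powr p) \<partial>lborel) \<le> ennreal P" by simp
    show "P \<ge> 0" unfolding P_def by (intro Bochner_Integration.integral_nonneg) auto
  qed

  \<comment> \<open>the volumes of the superlevel sets are finite and tend to \<open>0\<close>, by Chebyshev for \<open>\<bar>u\<bar>\<^sup>p\<close>\<close>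
  define a where "a k = measure lborel {x. u0 x > k}" for k
  have a_nonneg: "a k \<ge> 0" for k by (simp add: a_def)
  have cheb: "emeasure lborel {x. u0 x > k} \<le> ennreal (P / k powr p)" if "k > 0" for k
    using emeasure_superlevel_le[of u0 lborel p k P] that p P by simp
  have a_emeasure: "emeasure lborel {x. u0 x > k} = ennreal (a k)" if "k > 0" for k
    unfolding a_def using cheb[OF that]
    by (intro emeasure_eq_ennreal_measure) (auto simp: top_unique)
  have a_antimono: "a l \<le> a k" if "k > 0" "k \<le> l" for k l
  proof -
    have "emeasure lborel {x. u0 x > l} \<le> emeasure lborel {x. u0 x > k}"
      using that by (intro emeasure_mono) auto
    then show ?thesis using that by (simp add: a_emeasure a_nonneg)
  qed
  have a_le: "a k \<le> P / k powr p" if "k > 0" for k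
    using cheb[OF that] that P by (simp add: a_emeasure)
  have a_lim: "(a \<longlongrightarrow> 0) at_top"
  proof (rule tendsto_sandwich)
    show "eventually (\<lambda>k. 0 \<le> a k) at_top" by (simp add: a_nonneg)
    show "eventually (\<lambda>k. a k \<le> P / k powr p) at_top"
      using eventually_gt_at_top[of 0] by eventually_elim (rule a_le)
    show "((\<lambda>k. P / k powr p) \<longlongrightarrow> 0) at_top"
    proof -
      have "((\<lambda>k. P * k powr (- p)) \<longlongrightarrow> P * 0) at_top"
        using p by (intro tendsto_mult tendsto_const tendsto_neg_powr filterlim_ident) auto
      then show ?thesis by (simp add: powr_minus_divide)
    qed
  qed simp

  define S where "S = 2 powr m * jump_const DIM('a) s p"
  have S0: "S \<ge> 0" by (simp add: S_def jump_const_def)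
  define C where "C = (S * (\<bar>lam\<bar> * H powr (1 / r))) powr q * 2 powr m"
  have C0: "C \<ge> 0" by (simp add: C_def)

  have step: "a l \<le> 2 * C * (k / (l - k)) powr m * a k powr (1 + \<gamma>)"
    if k: "k > 0" "k < l" and small: "C * a k powr \<gamma> \<le> 1 / 2" for k l
  proof (cases "a k = 0")
    case True
    then show ?thesis using a_antimono[of k l] k a_nonneg[of l] by simp
  next
    case False
    with a_nonneg[of k] have ak: "a k > 0" by simp
    define w where "w = (\<lambda>x. max (u0 x - k) 0)"
    have [measurable]: "w \<in> borel_measurable borel" unfolding w_def by measurable
    have w0: "w x \<ge> 0" for x by (simp add: w_def)
    have supp: "emeasure lborel {x. w x > 0} \<le> ennreal (a k)"
      using a_emeasure[OF k(1)] by (simp add: w_def less_max_iff_disj)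
    have sobolev: "(\<integral>\<^sup>+x. ennreal (w x powr m) \<partial>lborel)
        \<le> ennreal ((S * a k powr (\<theta> - 1 / r) * e) powr q)"
      if "e \<ge> 0" "gagliardo_energy s p w \<le> ennreal e" for e
      unfolding S_def \<theta>_def N_def q_def
      using that w0 p s r r\<theta> m ak supp
      by (intro fractional_sobolev_inequality) (auto simp: \<theta>_def N_def)
    obtain I where I: "(\<integral>\<^sup>+x. ennreal (w x powr m) \<partial>lborel) = ennreal I" "I \<ge> 0"
    proof -
      have "gagliardo_energy s p w < \<infinity>"
        unfolding w_def by (rule truncation_energy_finite[OF p usob u0 eq])
      then obtain e where "e \<ge> 0" "gagliardo_energy s p w = ennreal e"
        by (cases "gagliardo_energy s p w") auto
      from sobolev[of e] this have "(\<integral>\<^sup>+x. ennreal (w x powr m) \<partial>lborel) < \<infinity>"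
        by (auto simp: le_less_trans)
      then show ?thesis using that
        by (cases "\<integral>\<^sup>+x. ennreal (w x powr m) \<partial>lborel") auto
    qed
    \<comment> \<open>bounds \<open>\<integral>\<^bsub>{u > k}\<^esub> \<bar>u\<bar>\<^sup>m\<close>, since \<open>u = w + k\<close> on this set\<close>
    define G where "G = 2 powr m * (I + k powr m * a k)"
    have G: "G > 0" using I ak k by (simp add: G_def add_nonneg_pos)
    define g where "g = (\<lambda>x. if u x > k then \<bar>u x\<bar> powr p else 0)"
    have gm: "g \<in> borel_measurable lebesgue" unfolding g_def using um by measurable
    have g_int: "(\<integral>\<^sup>+x. ennreal (g x powr q) \<partial>lebesgue_on \<Omega>) \<le> ennreal G"
    proof -
      have "(\<integral>\<^sup>+x. ennreal (g x powr q) \<partial>lebesgue_on \<Omega>)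
          = (\<integral>\<^sup>+x. ennreal (g x powr q) * indicator \<Omega> x \<partial>lebesgue)"
        using \<Omega> by (intro nn_integral_restrict_space) auto
      also have "\<dots> \<le> (\<integral>\<^sup>+x. ennreal (g x powr q) \<partial>lebesgue)"
        by (intro nn_integral_mono) (auto simp: indicator_def)
      also have "\<dots> = (\<integral>\<^sup>+x. ennreal (g x powr q) \<partial>lborel)"
        by (rule nn_integral_completion)
      also have "\<dots> \<le> (\<integral>\<^sup>+x. ennreal (2 powr m) *
            (ennreal (w x powr m) + ennreal (k powr m) * indicator {x. u0 x > k} x) \<partial>lborel)"
      proof (intro nn_integral_mono_AE eventually_mono[OF eq0])
        fix x assume x: "u x = u0 x"
        show "ennreal (g x powr q) \<le> ennreal (2 powr m) *
            (ennreal (w x powr m) + ennreal (k powr m) * indicator {x. u0 x > k} x)"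
        proof (cases "u0 x > k")
          case True
          then have "g x powr q = (w x + k) powr m"
            using x k by (simp add: g_def w_def powr_powr m_def)
          also have "\<dots> \<le> 2 powr m * (w x powr m + k powr m)"
            using k m w0 by (intro powr_add_le) auto
          finally show ?thesis using True
            by (simp flip: ennreal_mult ennreal_plus add: ennreal_leI)
        qed (use x in \<open>simp add: g_def\<close>)
      qed
      also have "\<dots> = ennreal (2 powr m) * (ennreal I + ennreal (k powr m) * ennreal (a k))"
        using I k by (simp add: nn_integral_cmult nn_integral_add a_emeasure)
      also have "\<dots> = ennreal G"
        using I ak by (simp add: G_def flip: ennreal_mult ennreal_plus)
      finally show ?thesis .
    qed
    have energy: "gagliardo_energy s p w \<le> ennreal (\<bar>lam\<bar> * (H powr (1 / r) * G powr (1 / q)))"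
    proof -
      have "gagliardo_energy s p w
          \<le> ennreal \<bar>lam\<bar> * (\<integral>\<^sup>+x. ennreal (\<bar>h x\<bar> * g x) \<partial>lebesgue_on \<Omega>)"
        unfolding w_def g_def using caccioppoli[OF p usob u0 eq sol _ \<Omega>, of k] k by simp
      also have "(\<integral>\<^sup>+x. ennreal (\<bar>h x\<bar> * g x) \<partial>lebesgue_on \<Omega>)
          \<le> ennreal (H powr (1 / r) * G powr (1 / q))"
        using r q H G g_int hm gm
        by (intro nn_integral_Holder) (auto simp: g_def intro: measurable_restrict_space1)
      finally show ?thesis by (simp add: ennreal_mult mult_left_mono)
    qed
    have "ennreal I \<le> ennreal ((S * a k powr (\<theta> - 1 / r) *
            (\<bar>lam\<bar> * (H powr (1 / r) * G powr (1 / q)))) powr q)"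
      unfolding I(1)[symmetric] by (intro sobolev energy) auto
    then have "I \<le> (S * a k powr (\<theta> - 1 / r) *
            (\<bar>lam\<bar> * (H powr (1 / r) * G powr (1 / q)))) powr q"
      by (subst (asm) ennreal_le_iff) auto
    also have "\<dots> = (S * (\<bar>lam\<bar> * H powr (1 / r))) powr q * (a k powr (\<theta> - 1 / r)) powr q
         * (G powr (1 / q)) powr q"
      using S0 by (simp add: powr_mult mult_ac)
    also have "\<dots> = C * a k powr \<gamma> * (I + k powr m * a k)"
      using q G by (simp add: powr_powr \<gamma>_def C_def) (simp add: G_def)
    also have "\<dots> = C * a k powr \<gamma> * I + C * a k powr \<gamma> * (k powr m * a k)"
      by (simp add: algebra_simps)
    also have "C * a k powr \<gamma> * I \<le> 1 / 2 * I"
      using small I by (intro mult_right_mono) auto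
    finally have "I \<le> 2 * C * k powr m * (a k * a k powr \<gamma>)" by (simp add: mult_ac)
    also have "a k * a k powr \<gamma> = a k powr (1 + \<gamma>)" using ak by (simp add: powr_add)
    finally have I_le: "I \<le> 2 * C * k powr m * a k powr (1 + \<gamma>)" .
    have "{x. u0 x > l} = {x. w x > l - k}" using k by (auto simp: w_def)
    moreover have "emeasure lborel {x. w x > l - k} \<le> ennreal (I / (l - k) powr m)"
      using emeasure_superlevel_le[of w lborel m "l - k" I] k m I w0 by simp
    ultimately have "a l \<le> I / (l - k) powr m"
      using a_emeasure[of l] k I by simp
    also have "\<dots> \<le> 2 * C * k powr m * a k powr (1 + \<gamma>) / (l - k) powr m"
      by (intro divide_right_mono I_le) auto
    also have "\<dots> = 2 * C * (k / (l - k)) powr m * a k powr (1 + \<gamma>)"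
      using k by (simp add: powr_divide)
    finally show ?thesis .
  qed

  have "((\<lambda>k. C * a k powr \<gamma>) \<longlongrightarrow> C * 0) at_top"
    by (intro tendsto_mult tendsto_const tendsto_zero_powrI[OF a_lim tendsto_const])
      (simp_all add: a_nonneg \<gamma>)
  then have "eventually (\<lambda>k. C * a k powr \<gamma> < 1 / 2) at_top"
    by (rule order_tendstoD(2)) simp
  then obtain k1 where k1: "\<And>k. k \<ge> k1 \<Longrightarrow> C * a k powr \<gamma> < 1 / 2"
    by (auto simp: eventually_at_top_linorder)
  have "\<exists>K \<ge> max k1 1. a K = 0"
  proof (rule fast_decay_imp_zero)
    show "a l \<le> 2 * C * (k / (l - k)) powr m * a k powr (1 + \<gamma>)"
      if "max k1 1 \<le> k" "k < l" for k l
      using k1[of k] that by (intro step) auto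
    show "a l \<le> a k" if "max k1 1 \<le> k" "k \<le> l" for k l
      using that by (intro a_antimono) auto
  qed (simp_all add: a_nonneg C0 m(1) \<gamma> a_lim)
  then obtain K where "K \<ge> max k1 1" and K0: "a K = 0" by blast
  then have K: "K > 0" by simp
  then have "emeasure lborel {x. u0 x > K} = 0" by (simp add: a_emeasure K0)
  then have "{x. u0 x > K} \<in> null_sets lborel" by auto
  then have "AE x in lborel. x \<notin> {x. u0 x > K}" by (rule AE_not_in)
  with eq0 have "AE x in lborel. u x \<le> K" by eventually_elim auto
  then show ?thesis by (intro exI[of _ K] AE_completion)
qed

lemma weak_solution_uminus:
  assumes "weak_solution s p \<Omega> h lam u"
  shows "weak_solution s p \<Omega> h lam (\<lambda>x. - u x)"
proof -
  have abs_eq: "\<bar>- u x - - u y\<bar> = \<bar>u x - u y\<bar>" for x y by linarith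
  have neg: "- u x - - u y = - (u x - u y)" for x y by simp
  have "(\<lambda>x. - u x) \<in> fractional_sobolev0 s p \<Omega>"
    using assms
    unfolding weak_solution_def fractional_sobolev0_def fractional_sobolev_def Lp_space_def
    by (simp only: mem_Collect_eq abs_eq abs_minus_cancel neg_equal_0_iff_equal
        borel_measurable_uminus_eq)
  then show ?thesis
    using assms unfolding weak_solution_def abs_eq
    by (simp only: neg abs_minus_cancel mult_minus_left mult_minus_right minus_divide_left[symmetric]
        case_prod_unfold integral_minus) simp
qed

theorem proposition3p2:
  fixes \<Omega> :: "(real ^ 'n) set"
    and h u :: "real ^ 'n \<Rightarrow> real"
    and s p lam :: real
  assumes "CARD('n) \<ge> 2"
    and "bounded_lipschitz_domain \<Omega>"
    and "1 < p"
    and "0 < s" and "s < 1"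
    and "h \<in> weight_class s p \<Omega> p"
    and "emeasure lebesgue {x \<in> \<Omega>. h x > 0} > 0"
    and "eigenfunction s p \<Omega> h lam u"
  shows "u \<in> Linf_space lebesgue"
proof -
  have sol: "weak_solution s p \<Omega> h lam u" using assms by (simp add: eigenfunction_def)
  have \<Omega>: "\<Omega> \<in> sets lebesgue" using assms by (auto simp: bounded_lipschitz_domain_def)
  have ps: "p > 1" "s > 0" using assms by auto
  obtain K where K: "AE x in lebesgue. u x \<le> K"
    using weak_solution_bounded_above[OF ps \<Omega> assms(6) sol] ..
  obtain L where L: "AE x in lebesgue. - u x \<le> L"
    using weak_solution_bounded_above[OF ps \<Omega> assms(6) weak_solution_uminus[OF sol]] ..
  from K L have "AE x in lebesgue. \<bar>u x\<bar> \<le> max K L" by eventually_elim auto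
  moreover have "u \<in> borel_measurable lebesgue"
    using sol by (simp add: weak_solution_def fractional_sobolev0_def fractional_sobolev_def Lp_space_def)
  ultimately show ?thesis by (auto simp: Linf_space_def)
qed

end
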